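(* Let $w$ be a complex number with $\operatorname{Re}(w)>-1$ and let $z$ be a complex number. Then $$\binom{w}{z}=\sum_{k=0}^{\infty}\binom{w}{k}\,\mathrm{sinc}(z-k).$$ Moreover, the series converges absolutely.
   Context: For $w\in\mathbb{C}$ not a negative integer and $z\in\mathbb{C}$, the generalized binomial coefficient is $\binom{w}{z}=\frac{\Gamma(w+1)}{\Gamma(z+1)\Gamma(w-z+1)}$, where the reciprocal gamma function $1/\Gamma$ is understood as an entire function (equal to $0$ at the nonpositive integers). For an integer $k\ge 1$ one has $\binom{w}{k}=\frac{w(w-1)\cdots(w-k+1)}{k!}$, and $\binom{w}{0}=1$. The function $\mathrm{sinc}:\mathbb{C}\to\mathbb{C}$ is defined by $\mathrm{sinc}(0)=1$ and $\mathrm{sinc}(z)=\frac{\sin(\pi z)}{\pi z}$ for $z\neq 0$. *)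

theory Defs
  imports "HOL-Analysis.Analysis"
begin

text \<open>
  The generalized binomial coefficient with complex lower argument. Here \<open>rGamma\<close> is the entire
  reciprocal gamma function, which vanishes at the nonpositive integers. The definition is
  meaningful when \<open>w\<close> is not a negative integer; at the negative integers the value is \<open>0\<close>, because
  \<open>Gamma\<close> is \<open>0\<close> at its poles by library convention.
\<close>

definition cbinomial :: "complex \<Rightarrow> complex \<Rightarrow> complex" where
  "cbinomial w z = Gamma (w + 1) * rGamma (z + 1) * rGamma (w - z + 1)"

text \<open>For natural lower arguments this is the library's \<open>gchoose\<close>.\<close>

lemma cbinomial_of_nat:
  assumes "w + 1 \<notin> \<int>\<^sub>\<le>\<^sub>0"
  shows "cbinomial w (of_nat k) = w gchoose k"
  using gbinomial_Gamma[OF assms, of k]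
  by (simp add: cbinomial_def Gamma_fact rGamma_inverse_Gamma field_simps)

text \<open>The normalized sinc function (the argument of the sine is scaled by \<open>pi\<close>).\<close>

definition csinc :: "complex \<Rightarrow> complex" where
  "csinc z = (if z = 0 then 1 else sin (of_real pi * z) / (of_real pi * z))"

end

theory Submission
  imports Defs
begin

text \<open>
  For \<open>z\<close> an integer, \<open>csinc (z - k)\<close> is a Kronecker delta. Otherwise
  \<open>csinc (z - k) = csinc z (-1)^k z / (z - k)\<close>, so that the series is \<open>csinc z\<close> times the
  hypergeometric series \<open>F(-w, -z; 1 - z; 1)\<close>. Its value is given by Gauss's summation theorem,
  which is proved by relating the parameters \<open>c\<close> and \<open>c + 1\<close> and letting \<open>c + N\<close> tend to infinity.
\<close>

section \<open>Growth and summability of hypergeometric terms\<close>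

definition hypergeometric_term :: "complex \<Rightarrow> complex \<Rightarrow> complex \<Rightarrow> nat \<Rightarrow> complex" where
  "hypergeometric_term a b c k =
     pochhammer a k * pochhammer b k / (fact k * pochhammer c k)"

text \<open>\<open>rGamma_series x n\<close> is \<open>pochhammer x (Suc n)\<close> divided by n!
  n^x. With two symbols above and two below the factorials cancel, which leaves convergent factors
  times a pure power of n.\<close>

lemma pochhammer_quotient_conv_rGamma_series:
  fixes p q r s :: complex
  shows "pochhammer p (Suc n) * pochhammer q (Suc n) / (pochhammer r (Suc n) * pochhammer s (Suc n)) =
         rGamma_series p n * rGamma_series q n / (rGamma_series r n * rGamma_series s n) *
         exp ((p + q - r - s) * of_real (ln (of_nat n)))"
proof -
  have *: "pochhammer x (Suc n) = rGamma_series x n * fact n * exp (x * of_real (ln (of_nat n)))"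
    for x :: complex
    by (simp add: rGamma_series_def)
  show ?thesis
    unfolding * by (simp add: ring_distribs exp_add exp_diff exp_minus field_simps)
qed

lemma rGamma_series_quotient_LIMSEQ:
  fixes p q r s :: complex
  assumes "r \<notin> \<int>\<^sub>\<le>\<^sub>0" "s \<notin> \<int>\<^sub>\<le>\<^sub>0"
  shows "(\<lambda>n. rGamma_series p n * rGamma_series q n / (rGamma_series r n * rGamma_series s n))
           \<longlonglongrightarrow> rGamma p * rGamma q * Gamma r * Gamma s"
proof -
  have "(\<lambda>n. rGamma_series p n * rGamma_series q n / (rGamma_series r n * rGamma_series s n))
           \<longlonglongrightarrow> rGamma p * rGamma q / (rGamma r * rGamma s)"
    using assms by (intro tendsto_intros) (auto simp: rGamma_eq_zero_iff)
  thus ?thesis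
    by (simp add: Gamma_def field_simps)
qed

text \<open>The balance condition makes the power of n trivial. The prefactor in
  \<open>hypergeometric_suminf_shift\<close> is balanced in this sense.\<close>

lemma pochhammer_quotient_LIMSEQ:
  fixes p q r s :: complex
  assumes "r \<notin> \<int>\<^sub>\<le>\<^sub>0" "s \<notin> \<int>\<^sub>\<le>\<^sub>0" "p + q = r + s"
  shows "(\<lambda>n. pochhammer p n * pochhammer q n / (pochhammer r n * pochhammer s n))
           \<longlonglongrightarrow> rGamma p * rGamma q * Gamma r * Gamma s"
proof -
  have "p + q - r - s = 0"
    using assms(3) by simp
  hence "(\<lambda>n. pochhammer p (Suc n) * pochhammer q (Suc n) /
            (pochhammer r (Suc n) * pochhammer s (Suc n)))
           \<longlonglongrightarrow> rGamma p * rGamma q * Gamma r * Gamma s"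
    unfolding pochhammer_quotient_conv_rGamma_series
    using rGamma_series_quotient_LIMSEQ[OF assms(1,2), of p q] by simp
  thus ?thesis
    by (rule LIMSEQ_imp_Suc)
qed

text \<open>Reading k! as \<open>pochhammer 1 k\<close> turns the term into a balanced-type
  quotient: a convergent, hence bounded, sequence times n^(a+b-1-c).\<close>

lemma hypergeometric_term_bound:
  assumes "c \<notin> \<int>\<^sub>\<le>\<^sub>0"
  obtains K where
    "\<And>n. n > 0 \<Longrightarrow> norm (hypergeometric_term a b c (Suc n)) \<le> K * of_nat n powr (Re (a + b - c) - 1)"
proof -
  define R where
    "R = (\<lambda>n. rGamma_series a n * rGamma_series b n / (rGamma_series 1 n * rGamma_series c n))"
  have "convergent R"
    using rGamma_series_quotient_LIMSEQ[of 1 c a b] assms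
    unfolding R_def convergent_def by auto
  then obtain K where K: "\<And>n. norm (R n) \<le> K"
    using convergent_imp_Bseq by (metis BseqE)
  show ?thesis
  proof
    fix n :: nat
    assume n: "n > 0"
    have "hypergeometric_term a b c (Suc n) =
            R n * exp ((a + b - 1 - c) * of_real (ln (of_nat n)))"
      unfolding hypergeometric_term_def R_def pochhammer_fact
        pochhammer_quotient_conv_rGamma_series ..
    \<comment> \<open>Positivity of n matters: at 0 the exponential is 1, but \<open>powr\<close>
      gives 0.\<close>
    also have "norm \<dots> = norm (R n) * of_nat n powr (Re (a + b - c) - 1)"
      using n by (simp add: norm_mult powr_def algebra_simps)
    also have "\<dots> \<le> K * of_nat n powr (Re (a + b - c) - 1)"
      using K by (intro mult_right_mono) auto
    finally show "norm (hypergeometric_term a b c (Suc n)) \<le> \<dots>" .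
  qed
qed

lemma summable_norm_hypergeometric_term:
  assumes "c \<notin> \<int>\<^sub>\<le>\<^sub>0" "Re (a + b) < Re c"
  shows "summable (\<lambda>k. norm (hypergeometric_term a b c k))"
proof -
  obtain K where K: "\<And>n. n > 0 \<Longrightarrow>
      norm (hypergeometric_term a b c (Suc n)) \<le> K * of_nat n powr (Re (a + b - c) - 1)"
    using hypergeometric_term_bound[OF assms(1)] by blast
  have "summable (\<lambda>n. K * of_nat n powr (Re (a + b - c) - 1))"
    using assms(2) by (intro summable_mult) (simp add: summable_real_powr_iff)
  moreover have "eventually (\<lambda>n. norm (norm (hypergeometric_term a b c (Suc n))) \<le>
      K * of_nat n powr (Re (a + b - c) - 1)) sequentially"
    using eventually_gt_at_top[of 0] by eventually_elim (use K in auto)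
  ultimately have "summable (\<lambda>n. norm (hypergeometric_term a b c (Suc n)))"
    by (rule summable_comparison_test_ev[rotated])
  thus ?thesis
    by (subst (asm) summable_Suc_iff)
qed

text \<open>This removes the boundary term at infinity when the contiguous relation is summed by
  telescoping.\<close>

lemma hypergeometric_term_times_index_LIMSEQ:
  assumes "c \<notin> \<int>\<^sub>\<le>\<^sub>0" "Re (a + b) < Re c"
  shows "(\<lambda>k. of_nat k * hypergeometric_term a b c k) \<longlonglongrightarrow> 0"
proof -
  obtain K where K: "\<And>n. n > 0 \<Longrightarrow>
      norm (hypergeometric_term a b c (Suc n)) \<le> K * of_nat n powr (Re (a + b - c) - 1)"
    using hypergeometric_term_bound[OF assms(1)] by blast
  have "(\<lambda>n. of_nat n powr Re (a + b - c)) \<longlonglongrightarrow> 0"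
    using assms(2) by (intro tendsto_neg_powr filterlim_real_sequentially) auto
  hence lim: "(\<lambda>n. 2 * K * of_nat n powr Re (a + b - c)) \<longlonglongrightarrow> 0"
    by (rule tendsto_mult_right_zero)
  have "(\<lambda>n. of_nat (Suc n) * hypergeometric_term a b c (Suc n)) \<longlonglongrightarrow> 0"
  proof (rule Lim_null_comparison[OF _ lim])
    show "eventually (\<lambda>n. norm (of_nat (Suc n) * hypergeometric_term a b c (Suc n)) \<le>
            2 * K * of_nat n powr Re (a + b - c)) sequentially"
      using eventually_gt_at_top[of 0]
    proof eventually_elim
      case (elim n)
      have "norm (of_nat (Suc n) * hypergeometric_term a b c (Suc n)) =
              of_nat (Suc n) * norm (hypergeometric_term a b c (Suc n))"
        by (simp only: norm_mult norm_of_nat)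
      \<comment> \<open>The factor 2 comes from n + 1 \<le> 2n for n > 0.\<close>
      also have "\<dots> \<le> (2 * of_nat n) * (K * of_nat n powr (Re (a + b - c) - 1))"
        using elim K[OF elim] by (intro mult_mono) auto
      also have "\<dots> = 2 * K * of_nat n powr Re (a + b - c)"
        using elim by (simp add: powr_diff)
      finally show ?case .
    qed
  qed
  thus ?thesis
    by (rule LIMSEQ_imp_Suc)
qed

section \<open>Contiguous relation between c and c + 1\<close>

lemma not_nonpos_Ints_add_of_nat:
  fixes c :: complex
  assumes "c \<notin> \<int>\<^sub>\<le>\<^sub>0"
  shows "c + of_nat n \<notin> \<int>\<^sub>\<le>\<^sub>0"
  using assms by (metis add_diff_cancel_right' nonpos_Ints_diff_Nats of_nat_in_Nats)

text \<open>All four terms are rational multiples of the term A at (c, k). Clearing c + k and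
  cancelling c A leaves (c-a-b)(c+k) - (c-a)(c-b) = k(c+k) - (a+k)(b+k), where both sides equal
  k(c-a-b) - ab.\<close>

lemma hypergeometric_term_telescope:
  assumes "c \<notin> \<int>\<^sub>\<le>\<^sub>0"
  shows "c * (c - a - b) * hypergeometric_term a b c k -
           (c - a) * (c - b) * hypergeometric_term a b (c + 1) k =
         c * (of_nat k * hypergeometric_term a b c k -
              of_nat (Suc k) * hypergeometric_term a b c (Suc k))"
proof -
  define A where "A = hypergeometric_term a b c k"
  have nz: "c + of_nat n \<noteq> 0" for n
    using not_nonpos_Ints_add_of_nat[OF assms, of n] by auto
  have c0: "c \<noteq> 0"
    using nz[of 0] by simp
  have p1: "pochhammer (c + 1) k = pochhammer c k * (c + of_nat k) / c"
    using c0 pochhammer_rec[of c k] pochhammer_Suc[of c k] by (simp add: field_simps)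
  have B: "hypergeometric_term a b (c + 1) k = A * c / (c + of_nat k)"
    unfolding A_def hypergeometric_term_def p1 by simp
  have C: "of_nat (Suc k) * hypergeometric_term a b c (Suc k) =
             A * (a + of_nat k) * (b + of_nat k) / (c + of_nat k)"
    unfolding A_def hypergeometric_term_def pochhammer_Suc fact_Suc
    by (simp add: mult_ac del: of_nat_Suc)
  show ?thesis
    unfolding B C A_def[symmetric] using nz[of k] by (simp add: field_simps)
qed

lemma hypergeometric_suminf_contiguous:
  assumes "c \<notin> \<int>\<^sub>\<le>\<^sub>0" "Re (a + b) < Re c"
  shows "c * (c - a - b) * (\<Sum>k. hypergeometric_term a b c k) =
         (c - a) * (c - b) * (\<Sum>k. hypergeometric_term a b (c + 1) k)"
proof -
  have "c + 1 \<notin> \<int>\<^sub>\<le>\<^sub>0"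
    using not_nonpos_Ints_add_of_nat[OF assms(1), of 1] by simp
  hence "(\<lambda>k. c * (c - a - b) * hypergeometric_term a b c k -
           (c - a) * (c - b) * hypergeometric_term a b (c + 1) k) sums
         (c * (c - a - b) * (\<Sum>k. hypergeometric_term a b c k) -
           (c - a) * (c - b) * (\<Sum>k. hypergeometric_term a b (c + 1) k))"
    using assms
    by (intro sums_diff sums_mult summable_sums summable_norm_cancel[OF summable_norm_hypergeometric_term])
       auto
  \<comment> \<open>Both ends of the telescoping sum vanish: the initial one through the factor 0,
    the one at infinity by the decay of k times the term.\<close>
  moreover have "(\<lambda>k. c * (of_nat k * hypergeometric_term a b c k -
              of_nat (Suc k) * hypergeometric_term a b c (Suc k))) sums
         (c * (of_nat 0 * hypergeometric_term a b c 0 - 0))"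
    by (intro sums_mult telescope_sums' hypergeometric_term_times_index_LIMSEQ assms)
  ultimately show ?thesis
    unfolding hypergeometric_term_telescope[OF assms(1)]
    by (auto dest: sums_unique2)
qed

lemma hypergeometric_suminf_shift:
  assumes "c \<notin> \<int>\<^sub>\<le>\<^sub>0" "Re (a + b) < Re c"
  shows "(\<Sum>k. hypergeometric_term a b c k) =
           pochhammer (c - a) n * pochhammer (c - b) n /
             (pochhammer c n * pochhammer (c - a - b) n) *
           (\<Sum>k. hypergeometric_term a b (c + of_nat n) k)"
proof (induction n)
  case (Suc n)
  define d where "d = c + of_nat n"
  have d: "d \<notin> \<int>\<^sub>\<le>\<^sub>0" "Re (a + b) < Re d"
    using not_nonpos_Ints_add_of_nat[OF assms(1), of n] assms(2) by (auto simp: d_def)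
  \<comment> \<open>The second factor is nonzero because its real part is positive.\<close>
  have nz: "d \<noteq> 0" "d - a - b \<noteq> 0"
    using d by (auto simp: complex_eq_iff[of "d - a - b"])
  have "(\<Sum>k. hypergeometric_term a b d k) =
          (d - a) * (d - b) / (d * (d - a - b)) * (\<Sum>k. hypergeometric_term a b (d + 1) k)"
    using hypergeometric_suminf_contiguous[OF d] nz by (simp add: eq_divide_eq mult_ac)
  moreover have e: "c - a + of_nat n = d - a" "c - b + of_nat n = d - b" "c + of_nat n = d"
    "c - a - b + of_nat n = d - a - b" "c + of_nat (Suc n) = d + 1"
    by (simp_all add: d_def)
  ultimately show ?case
    unfolding pochhammer_Suc e Suc.IH by (simp only: times_divide_times_eq mult_ac)
qed auto

section \<open>The limit of large lower parameter\<close>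

lemma inverse_pochhammer_add_of_nat_LIMSEQ:
  fixes c :: complex
  shows "(\<lambda>n. inverse (pochhammer (c + of_nat n) k)) \<longlonglongrightarrow> (if k = 0 then 1 else 0)"
proof (induction k)
  case (Suc k)
  have "filterlim (\<lambda>n. (c + of_nat k) + of_nat n) at_infinity sequentially"
    by (rule tendsto_add_filterlim_at_infinity[OF tendsto_const tendsto_of_nat])
  hence "(\<lambda>n. inverse (c + of_nat n + of_nat k)) \<longlonglongrightarrow> 0"
    by (intro filterlim_compose[OF tendsto_inverse_0]) (simp add: algebra_simps)
  from tendsto_mult[OF Suc.IH this] show ?case
    by (simp add: pochhammer_Suc)
qed auto

lemma norm_pochhammer_le: "norm (pochhammer a k) \<le> pochhammer (norm a) k"
  for a :: complex
  unfolding pochhammer_prod prod_norm[symmetric]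
  by (auto intro!: prod_mono order.trans[OF norm_triangle_ineq])

text \<open>Factor by factor, |c + i| \<ge> Re c + i \<ge> x + i \<ge> 0. This bounds the
  denominators of the series from below.\<close>

lemma norm_pochhammer_ge:
  fixes c :: complex
  assumes "0 \<le> x" "x \<le> Re c"
  shows "pochhammer x k \<le> norm (pochhammer c k)"
proof -
  have "x + of_nat i \<le> norm (c + of_nat i)" for i
    using assms complex_Re_le_cmod[of "c + of_nat i"] by simp
  thus ?thesis
    using assms unfolding pochhammer_prod prod_norm[symmetric]
    by (auto intro!: prod_mono)
qed

text \<open>Termwise only k = 0 survives; Tannery's theorem allows the limit to be taken inside the
  sum.\<close>

lemma hypergeometric_suminf_LIMSEQ:
  "(\<lambda>n. \<Sum>k. hypergeometric_term a b (c + of_nat n) k) \<longlonglongrightarrow> 1"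
proof -
  \<comment> \<open>Any positive x > |a| + |b| makes the series with parameters |a|, |b|, x
    converge, and its terms serve as a majorant independent of n.\<close>
  define x where "x = norm a + norm b + 1"
  define M where "M = (\<lambda>k. norm (hypergeometric_term (of_real (norm a)) (of_real (norm b)) (of_real x) k))"
  have x: "x > 0"
    by (simp add: x_def add_nonneg_pos)
  have "summable M"
    unfolding M_def
  proof (rule summable_norm_hypergeometric_term)
    show "complex_of_real x \<notin> \<int>\<^sub>\<le>\<^sub>0"
      using x by (auto elim!: nonpos_Ints_cases simp: complex_eq_iff)
  qed (simp add: x_def)
  have nn: "pochhammer (norm u) k \<ge> 0" for u :: complex and k
    using norm_pochhammer_le[of u k] norm_ge_zero order.trans by blast
  have M_eq: "M k = pochhammer (norm a) k * pochhammer (norm b) k / (fact k * pochhammer x k)" for k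
    using x by (simp add: M_def hypergeometric_term_def norm_mult norm_divide pochhammer_of_real
                  abs_of_nonneg[OF nn] abs_of_pos[OF pochhammer_pos])
  \<comment> \<open>From this n on, Re (c + n) \<ge> x, so \<open>norm_pochhammer_ge\<close>
    applies.\<close>
  have "eventually (\<lambda>n. x - Re c \<le> real n) sequentially"
    using filterlim_real_sequentially unfolding filterlim_at_top by blast
  hence bound: "eventually (\<lambda>n. \<forall>k. norm (hypergeometric_term a b (c + of_nat n) k) \<le> M k) sequentially"
  proof eventually_elim
    case (elim n)
    show ?case
    proof
      fix k
      have "norm (hypergeometric_term a b (c + of_nat n) k) =
              norm (pochhammer a k) * norm (pochhammer b k) /
                (fact k * norm (pochhammer (c + of_nat n) k))"
        by (simp add: hypergeometric_term_def norm_mult norm_divide)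
      also have "\<dots> \<le> M k"
        unfolding M_eq using x elim
        by (intro frac_le mult_mono mult_left_mono norm_pochhammer_le norm_pochhammer_ge)
           (auto intro!: mult_pos_pos pochhammer_pos mult_nonneg_nonneg nn)
      finally show "norm (hypergeometric_term a b (c + of_nat n) k) \<le> M k" .
    qed
  qed
  have "(\<lambda>n. \<Sum>k. hypergeometric_term a b (c + of_nat n) k) \<longlonglongrightarrow> (\<Sum>k. if k = 0 then 1 else 0)"
  proof (rule tannerys_theorem[THEN conjunct2, THEN conjunct2])
    show "(\<lambda>n. hypergeometric_term a b (c + of_nat n) k) \<longlonglongrightarrow> (if k = 0 then 1 else 0)" for k
      using tendsto_mult_left[OF inverse_pochhammer_add_of_nat_LIMSEQ[of c k],
              of "pochhammer a k * pochhammer b k / fact k"]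
      by (cases "k = 0") (simp_all add: hypergeometric_term_def field_simps)
    show "eventually (\<lambda>(k, n). norm (hypergeometric_term a b (c + of_nat n) k) \<le> M k)
            (at_top \<times>\<^sub>F sequentially)"
      using eventually_prodI[OF eventually_True bound]
      by (rule eventually_mono) auto
  qed (use \<open>summable M\<close> in auto)
  moreover have "(\<Sum>k::nat. if k = 0 then 1 else 0) = (1 :: complex)"
    using sums_single[of 0 "\<lambda>_. 1 :: complex"] by (rule sums_unique[symmetric])
  ultimately show ?thesis
    by simp
qed

text \<open>In \<open>hypergeometric_suminf_shift\<close> the left side does not depend on n, while
  on the right the prefactor tends to the Gamma quotient and the shifted sum to 1.\<close>

theorem gauss_hypergeometric_sums:
  assumes "c \<notin> \<int>\<^sub>\<le>\<^sub>0" "Re (a + b) < Re c"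
  shows "hypergeometric_term a b c sums
           (rGamma (c - a) * rGamma (c - b) * Gamma c * Gamma (c - a - b))"
proof -
  have "c - a - b \<notin> \<int>\<^sub>\<le>\<^sub>0"
    using assms(2) by (auto elim!: nonpos_Ints_cases simp: complex_eq_iff)
  hence "(\<lambda>n. pochhammer (c - a) n * pochhammer (c - b) n /
             (pochhammer c n * pochhammer (c - a - b) n) *
           (\<Sum>k. hypergeometric_term a b (c + of_nat n) k)) \<longlonglongrightarrow>
         rGamma (c - a) * rGamma (c - b) * Gamma c * Gamma (c - a - b) * 1"
    using assms(1)
    by (intro tendsto_mult pochhammer_quotient_LIMSEQ hypergeometric_suminf_LIMSEQ) auto
  hence "(\<Sum>k. hypergeometric_term a b c k) =
           rGamma (c - a) * rGamma (c - b) * Gamma c * Gamma (c - a - b)"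
    unfolding hypergeometric_suminf_shift[OF assms, symmetric]
    by (simp add: LIMSEQ_const_iff)
  thus ?thesis
    using summable_sums[OF summable_norm_cancel[OF summable_norm_hypergeometric_term[OF assms]]]
    by simp
qed

section \<open>Sinc values and the binomial series\<close>

lemma csinc_of_int: "csinc (of_int n) = (if n = 0 then 1 else 0)"
  using sin_eq_0[of "of_real pi * of_int n"] by (auto simp: csinc_def mult.commute)

text \<open>Euler's reflection formula, with the division by z absorbed by z
  \<open>rGamma (z + 1)\<close> = \<open>rGamma z\<close>.\<close>

lemma csinc_conv_rGamma:
  assumes "z \<noteq> 0"
  shows "csinc z = rGamma (1 + z) * rGamma (1 - z)"
proof -
  have "csinc z = (rGamma z * rGamma (1 - z)) / z"
    unfolding rGamma_reflection_complex using assms by (simp add: csinc_def)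
  also have "\<dots> = rGamma (1 + z) * rGamma (1 - z)"
    using assms rGamma_plus1[of z] by (simp add: add.commute field_simps)
  finally show ?thesis .
qed

lemma sin_diff_of_nat_times_pi:
  "sin (of_real pi * (z - of_nat k)) = (-1) ^ k * sin (of_real pi * z :: complex)"
proof (induction k)
  case (Suc k)
  have "of_real pi * (z - of_nat (Suc k)) = of_real pi * (z - of_nat k) - of_real pi"
    by (simp add: algebra_simps)
  thus ?case
    using Suc by (simp only: sin_diff) simp
qed simp

text \<open>The sign in w choose k = (-1)^k (-w)_k / k! cancels the one from shifting the sine, and
  z / (z - k) is the quotient (-z)_k / (1-z)_k.\<close>

lemma gbinomial_csinc_conv_hypergeometric_term:
  assumes "z \<notin> \<int>"
  shows "(w gchoose k) * csinc (z - of_nat k) = csinc z * hypergeometric_term (-w) (-z) (1 - z) k"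
proof -
  have nz: "z \<noteq> 0" "z \<noteq> of_nat k"
    using assms by auto
  have pnz: "pochhammer (-z) k \<noteq> 0"
    using assms by (auto simp: pochhammer_eq_0_iff)
  \<comment> \<open>Both sides are \<open>pochhammer (-z) (Suc k)\<close>, with the last and the
    first factor split off respectively.\<close>
  have "(-z + of_nat k) * pochhammer (-z) k = -z * pochhammer (1 - z) k"
    using pochhammer_rec[of "-z" k] pochhammer_rec'[of "-z" k] by (simp add: add.commute)
  hence p: "pochhammer (1 - z) k = pochhammer (-z) k * (z - of_nat k) / z"
    using nz by (simp add: field_simps)
  have c: "csinc (z - of_nat k) = (-1) ^ k * csinc z * z / (z - of_nat k)"
    using nz by (simp add: csinc_def sin_diff_of_nat_times_pi)
  show ?thesis
    using nz pnz
    by (simp add: hypergeometric_term_def p gbinomial_pochhammer c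
          power_mult_distrib[symmetric])
qed

lemma cbinomial_of_int_neg: "n < 0 \<Longrightarrow> cbinomial w (of_int n) = 0"
proof -
  assume "n < 0"
  hence "(of_int (n + 1) :: complex) \<in> \<int>\<^sub>\<le>\<^sub>0"
    by (intro nonpos_Ints_of_int) auto
  thus ?thesis
    by (simp add: cbinomial_def rGamma_eq_zero_iff)
qed

theorem theorem2:
  fixes w z :: complex
  assumes "Re w > -1"
  shows "(\<lambda>k::nat. cbinomial w (of_nat k) * csinc (z - of_nat k)) sums cbinomial w z \<and>
         summable (\<lambda>k::nat. norm (cbinomial w (of_nat k) * csinc (z - of_nat k)))"
proof (cases "z \<in> \<int>")
  case True
  then obtain n where z: "z = of_int n"
    by (auto elim: Ints_cases)
  define f where "f = (\<lambda>k::nat. cbinomial w (of_nat k) * csinc (z - of_nat k))"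
  have f: "f k = (if int k = n then cbinomial w z else 0)" for k
    using csinc_of_int[of "n - int k"] by (auto simp: f_def z)
  have zero: "f k = 0" if "k \<notin> {nat n}" for k
    using that by (auto simp: f)
  \<comment> \<open>For n < 0 the index \<open>nat n\<close> is 0, where f vanishes, and the
    binomial coefficient vanishes as well.\<close>
  have "sum f {nat n} = cbinomial w z"
    using cbinomial_of_int_neg[of n w] by (auto simp: f z)
  hence "f sums cbinomial w z"
    using sums_finite[of "{nat n}" f] zero by simp
  moreover have "summable (\<lambda>k. norm (f k))"
    using zero by (intro summable_finite[of "{nat n}"]) auto
  ultimately show ?thesis
    by (simp add: f_def)
next
  case False
  have w: "w + 1 \<notin> \<int>\<^sub>\<le>\<^sub>0"
    using assms by (auto elim!: nonpos_Ints_cases simp: complex_eq_iff)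
  have "1 - z \<notin> \<int>"
    using False by (metis Ints_1 Ints_diff diff_diff_eq2 add_diff_cancel_left')
  hence z: "1 - z \<notin> \<int>\<^sub>\<le>\<^sub>0" "1 + z - z \<notin> \<int>\<^sub>\<le>\<^sub>0" "z \<noteq> 0"
    using False by (auto dest: nonpos_Ints_Int)
  \<comment> \<open>With a = -w, b = -z, c = 1 - z one has c - a - b = w + 1, so Gauss's convergence
    condition is exactly Re w > -1.\<close>
  have re: "Re (-w + -z) < Re (1 - z)"
    using assms by simp
  have eq: "cbinomial w (of_nat k) * csinc (z - of_nat k) =
              csinc z * hypergeometric_term (-w) (-z) (1 - z) k" for k
    unfolding cbinomial_of_nat[OF w] by (rule gbinomial_csinc_conv_hypergeometric_term[OF False])
  \<comment> \<open>The \<open>rGamma (1 - z)\<close> inside \<open>csinc z\<close> cancels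
    \<open>Gamma (1 - z)\<close> in Gauss's value; since c - b = 1, the factors left are those of
    \<open>cbinomial w z\<close>.\<close>
  have "rGamma (1 - z) * Gamma (1 - z) = 1"
    using z(1) by (simp add: Gamma_def rGamma_eq_zero_iff)
  hence "csinc z * (rGamma (1 - z - -w) * rGamma (1 - z - -z) * Gamma (1 - z) * Gamma (1 - z - -w - -z))
          = cbinomial w z"
    by (simp add: csinc_conv_rGamma[OF z(3)] cbinomial_def algebra_simps)
  moreover have "(\<lambda>k. csinc z * hypergeometric_term (-w) (-z) (1 - z) k) sums
      (csinc z * (rGamma (1 - z - -w) * rGamma (1 - z - -z) * Gamma (1 - z) * Gamma (1 - z - -w - -z)))"
    by (intro sums_mult gauss_hypergeometric_sums z re)
  moreover have "summable (\<lambda>k. norm (csinc z * hypergeometric_term (-w) (-z) (1 - z) k))"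
    unfolding norm_mult by (intro summable_mult summable_norm_hypergeometric_term z re)
  ultimately show ?thesis
    unfolding eq by simp
qed

end
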